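(* Let $\{Z_n\}_{n\ge 0}$ be a branching process in an i.i.d. random environment, with $X=\ln m_0$, $\mu=\mathbb{E}X$, $\sigma^2=\mathbb{E}(X-\mu)^2$ as in the context, such that almost surely every individual has at least one child and $0<\sigma^2<\infty$. Assume that there exists a constant $H>0$ such that $$\mathbb{E}(X-\mu)^k\le \tfrac12\, k!\,H^{k-2}\,\mathbb{E}(X-\mu)^2\qquad\text{for all integers } k\ge 2.$$ Then for all integers $n_0\ge 0$, $n\ge 1$ and all real $x>0$, $$\mathbb{P}\left(\frac{\ln\frac{Z_{n_0+n}}{Z_{n_0}}-n\mu}{\sigma\sqrt n}\ge x\right)\le 2\exp\left\{-\frac{x^2}{2\left(1+6(1+H)\frac{x}{\sigma\sqrt n}\right)}\right\}.$$
   Context: Branching process in a random environment: $\xi=(\xi_0,\xi_1,\dots)$ is a sequence of i.i.d. random variables (the environment). Each value of $\xi_n$ determines a probability distribution $p(\xi_n)=\{p_n(i): i\in\mathbb{N}\}$ on $\mathbb{N}=\{0,1,2,\dots\}$ (the offspring law at generation $n$). The process is defined by $Z_0=1$ and $Z_{n+1}=\sum_{i=1}^{Z_n}N_{n,i}$ for $n\ge 0$, where, conditionally on $\xi$, the variables $\{N_{n,i}: n\ge0,i\ge1\}$ are independent and, for each $n$, the $N_{n,i}$ $(i\ge1)$ have common law $p(\xi_n)$. $\mathbb{P}$ is the total (annealed) law, i.e. $\mathbb{P}(dx,d\xi)=\mathbb{P}_\xi(dx)\tau(d\xi)$ with $\mathbb{P}_\xi$ the conditional law given $\xi$ and $\tau$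 the law of $\xi$; $\mathbb{E}$ is the corresponding expectation. Put $m_n=\sum_{i\ge0} i\,p_n(i)$ (conditional mean offspring number at generation $n$ given $\xi$), $X=\ln m_0$, $\mu=\mathbb{E}X$, $\sigma^2=\mathbb{E}(X-\mu)^2$, $\sigma>0$. Standing assumption: $p_0(0)=0$ almost surely (the probability of having no children is zero) and $0<\sigma^2<\infty$; hence $Z_n\ge1$ a.s. for all $n$. *)

theory Defs
  imports "HOL-Probability.Probability"
begin

text \<open>
  The environment \<open>\<xi>\<close> takes values in an arbitrary measurable space \<open>E\<close>, and \<open>p\<close> maps an
  environment value to an offspring law on the natural numbers; \<open>N n i\<close>, with \<open>i \<ge> 1\<close>, is the
  number of children of the \<open>i\<close>-th individual of generation \<open>n\<close> (the variables \<open>N n 0\<close> are unused).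

  The assumption \<open>cond_law\<close> is conditional independence together with the conditional laws:
  given the whole environment sequence, the joint probability of finitely many events
  \<open>N n i \<in> B n i\<close> is the product of the probabilities \<open>p (\<xi> n) (B n i)\<close>.
\<close>

locale branching_process_random_env = prob_space M
  for M :: "'a measure" +
  fixes E :: "'e measure"
    and \<xi> :: "nat \<Rightarrow> 'a \<Rightarrow> 'e"
    and p :: "'e \<Rightarrow> nat pmf"
    and N :: "nat \<Rightarrow> nat \<Rightarrow> 'a \<Rightarrow> nat"
  assumes env_indep: "indep_vars (\<lambda>_. E) \<xi> UNIV"
    and env_ident: "\<And>n. distr M E (\<xi> n) = distr M E (\<xi> 0)"
    and offspring_kernel:
      "(\<lambda>e. measure_pmf (p e)) \<in> E \<rightarrow>\<^sub>M prob_algebra (count_space UNIV)"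
    and N_measurable: "\<And>n i. 1 \<le> i \<Longrightarrow> N n i \<in> M \<rightarrow>\<^sub>M count_space UNIV"
    and cond_law:
      "\<And>J B. finite J \<Longrightarrow> J \<subseteq> UNIV \<times> {1..} \<Longrightarrow>
        AE \<omega> in M.
          real_cond_exp M
            (vimage_algebra (space M) (\<lambda>\<omega> n. \<xi> n \<omega>) (PiM UNIV (\<lambda>_. E)))
            (indicator {\<omega> \<in> space M. \<forall>(n, i) \<in> J. N n i \<omega> \<in> B n i}) \<omega>
          = (\<Prod>(n, i) \<in> J. measure_pmf.prob (p (\<xi> n \<omega>)) (B n i))"

primrec population :: "(nat \<Rightarrow> nat \<Rightarrow> 'a \<Rightarrow> nat) \<Rightarrow> nat \<Rightarrow> 'a \<Rightarrow> nat" where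
  "population N 0 \<omega> = 1"
| "population N (Suc n) \<omega> = (\<Sum>i = 1..population N n \<omega>. N n i \<omega>)"

text \<open>
  The value of \<open>offspring_mean\<close> is meaningful only where the mean is finite; where the series
  diverges the Bochner integral is 0, so finiteness has to be assumed separately.
\<close>

definition offspring_mean :: "(nat \<Rightarrow> 'a \<Rightarrow> 'e) \<Rightarrow> ('e \<Rightarrow> nat pmf) \<Rightarrow> nat \<Rightarrow> 'a \<Rightarrow> real" where
  "offspring_mean \<xi> p n \<omega> = measure_pmf.expectation (p (\<xi> n \<omega>)) real"

end

theory Submission
  imports Defs
begin

text \<open>
  Write \<open>ln (Z (n\<^sub>0 + n) / Z n\<^sub>0) - n \<mu> = S + ln W\<close>, where \<open>S\<close> is the centred sum of the \<open>n\<close>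
  i.i.d. log means and \<open>W\<close> is the population ratio divided by the product of the means.
  With \<open>s = x \<sigma> \<surd>n\<close> and \<open>t\<close> the exponent of the claim, the event \<open>S + ln W \<ge> s\<close> is covered by
  \<open>ln W \<ge> t\<close> and \<open>S \<ge> s - t\<close>. The first has probability at most \<open>exp (- t)\<close> by Markov's
  inequality, since \<open>W\<close> has expectation at most 1; the second by Bernstein's inequality, because
  \<open>t \<le> s / 12\<close> makes the loss from \<open>s\<close> to \<open>s - t\<close> fit into the constant \<open>6 (1 + H)\<close>.
\<close>

section \<open>Bernstein's inequality from bounds on signed moments\<close>

text \<open>For negative \<open>x\<close> the Lagrange remainder of odd order
  \<open>2 * k + 1\<close> is nonpositive, so the partial sum of degree \<open>2 * k\<close> is at
  least \<open>exp x\<close>.\<close>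

lemma exp_even_partial_sum_nonneg:
  fixes x :: real
  shows "0 \<le> (\<Sum>m<2 * k + 1. x ^ m / fact m)"
proof (cases "x \<ge> 0")
  case True
  then show ?thesis by (intro sum_nonneg) auto
next
  case False
  obtain t where t: "exp x = (\<Sum>m<2 * k + 1. x ^ m / fact m) + exp t / fact (2 * k + 1) * x ^ (2 * k + 1)"
    using Maclaurin_exp_le[of x "2 * k + 1"] by blast
  have "x ^ (2 * k + 1) \<le> 0"
    using False by (simp add: mult_nonpos_nonneg)
  then have "exp t / fact (2 * k + 1) * x ^ (2 * k + 1) \<le> 0"
    by (intro mult_nonneg_nonpos) auto
  with t show ?thesis
    using exp_gt_zero[of x] by linarith
qed

context prob_space
begin

text \<open>
  No absolute moments are available, so the exponential series cannot be dominated directly.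
  Its partial sums of even degree are nonnegative, however, and Fatou's lemma suffices for the
  upper bound.
\<close>

lemma bernstein_mgf_bound:
  fixes Y :: "'a \<Rightarrow> real"
  assumes Y: "integrable M Y" "expectation Y = 0"
    and moments: "\<And>k. k \<ge> 2 \<Longrightarrow> integrable M (\<lambda>\<omega>. Y \<omega> ^ k)"
      "\<And>k. k \<ge> 2 \<Longrightarrow> expectation (\<lambda>\<omega>. Y \<omega> ^ k) \<le> 1 / 2 * fact k * H ^ (k - 2) * v"
    and nonneg: "0 \<le> v" "0 \<le> H" "0 \<le> l" and lH: "l * H < 1"
  shows "(\<integral>\<^sup>+\<omega>. ennreal (exp (l * Y \<omega>)) \<partial>M) \<le> ennreal (exp (l\<^sup>2 * v / (2 * (1 - l * H))))"
proof -
  have [measurable]: "Y \<in> borel_measurable M" using Y by auto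
  define a where "a = (\<lambda>m. expectation (\<lambda>\<omega>. (l * Y \<omega>) ^ m / fact m))"
  have int: "integrable M (\<lambda>\<omega>. (l * Y \<omega>) ^ m / fact m)" for m
  proof -
    consider "m = 0" | "m = 1" | "m \<ge> 2" by linarith
    then have "integrable M (\<lambda>\<omega>. Y \<omega> ^ m)"
      using Y(1) moments(1) by cases auto
    then show ?thesis by (simp add: power_mult_distrib)
  qed
  \<comment> \<open>The factorial in the moment bound cancels the one in the exponential series.
    What remains is a geometric series of ratio \<open>l * H\<close>, which is where
    \<open>l * H < 1\<close> enters.\<close>
  have a_le: "a (m + 2) \<le> l\<^sup>2 * v / 2 * (l * H) ^ m" for m
  proof -
    have "a (m + 2) = l ^ (m + 2) / fact (m + 2) * expectation (\<lambda>\<omega>. Y \<omega> ^ (m + 2))"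
      by (simp add: a_def power_mult_distrib)
    also have "\<dots> \<le> l ^ (m + 2) / fact (m + 2) * (1 / 2 * fact (m + 2) * H ^ (m + 2 - 2) * v)"
      using nonneg by (intro mult_left_mono moments(2)) auto
    also have "\<dots> = l\<^sup>2 * v / 2 * (l * H) ^ m"
      by (simp del: fact_Suc add: power_add power_mult_distrib power2_eq_square)
    finally show ?thesis .
  qed
  have a01: "a 0 = 1" "a (Suc 0) = 0"
    using Y by (simp_all add: a_def prob_space)
  \<comment> \<open>The first two terms are split off: the constant term is 1 and the linear one
    vanishes because \<open>Y\<close> is centred.\<close>
  have partial: "(\<Sum>m<n + 2. a m) \<le> 1 + l\<^sup>2 * v / 2 * (\<Sum>i<n. (l * H) ^ i)" for n
  proof (induction n)
    case 0
    show ?case by (simp add: a01 numeral_2_eq_2)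
  next
    case (Suc n)
    show ?case using Suc.IH a_le[of n] by (simp add: distrib_left)
  qed
  have r: "0 \<le> l * H" using nonneg by simp
  have bound: "(\<Sum>m<n + 2. a m) \<le> exp (l\<^sup>2 * v / (2 * (1 - l * H)))" for n
  proof -
    have "(\<Sum>i<n. (l * H) ^ i) \<le> 1 / (1 - l * H)"
      using sum_le_suminf[OF summable_geometric, of "l * H" "{..<n}"] suminf_geometric[of "l * H"]
        r lH by simp
    then have "1 + l\<^sup>2 * v / 2 * (\<Sum>i<n. (l * H) ^ i) \<le> 1 + l\<^sup>2 * v / 2 * (1 / (1 - l * H))"
      using nonneg by (intro add_left_mono mult_left_mono) auto
    also have "\<dots> = 1 + l\<^sup>2 * v / (2 * (1 - l * H))" by simp
    also have "\<dots> \<le> exp (l\<^sup>2 * v / (2 * (1 - l * H)))" by (rule exp_ge_add_one_self)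
    finally show ?thesis using partial[of n] by linarith
  qed
  define T where "T = (\<lambda>k \<omega>. \<Sum>m<2 * k + 1. (l * Y \<omega>) ^ m / fact m)"
  have T_M [measurable]: "T k \<in> borel_measurable M" for k
    unfolding T_def by measurable
  have T_int: "(\<integral>\<^sup>+\<omega>. ennreal (T (Suc k) \<omega>) \<partial>M) \<le> ennreal (exp (l\<^sup>2 * v / (2 * (1 - l * H))))" for k
  proof -
    have "(\<integral>\<^sup>+\<omega>. ennreal (T (Suc k) \<omega>) \<partial>M) = ennreal (expectation (T (Suc k)))"
      unfolding T_def
      by (intro nn_integral_eq_integral Bochner_Integration.integrable_sum int
          AE_I2 exp_even_partial_sum_nonneg)
    \<comment> \<open>The shift to \<open>Suc k\<close> guarantees at least two terms, so that the
      number of terms has the form \<open>n + 2\<close> required by \<open>bound\<close>.\<close>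
    also have "expectation (T (Suc k)) = (\<Sum>m<(2 * k + 1) + 2. a m)"
      unfolding T_def a_def using int by (subst Bochner_Integration.integral_sum) auto
    finally show ?thesis
      using bound[of "2 * k + 1"] by (simp only: ennreal_leI)
  qed
  have T_lim: "(\<lambda>k. ennreal (T (Suc k) \<omega>)) \<longlonglongrightarrow> ennreal (exp (l * Y \<omega>))" for \<omega>
  proof (rule tendsto_ennrealI)
    have "(\<lambda>n. \<Sum>m<n. (l * Y \<omega>) ^ m / fact m) \<longlonglongrightarrow> exp (l * Y \<omega>)"
      using exp_converges[of "l * Y \<omega>"] by (simp add: sums_def divide_inverse mult.commute)
    then show "(\<lambda>k. T (Suc k) \<omega>) \<longlonglongrightarrow> exp (l * Y \<omega>)"
      unfolding T_def
      by (rule filterlim_compose) (auto intro!: filterlim_subseq strict_monoI)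
  qed
  have "(\<integral>\<^sup>+\<omega>. ennreal (exp (l * Y \<omega>)) \<partial>M) = (\<integral>\<^sup>+\<omega>. liminf (\<lambda>k. ennreal (T (Suc k) \<omega>)) \<partial>M)"
    by (intro nn_integral_cong lim_imp_Liminf[symmetric] T_lim) simp
  also have "\<dots> \<le> liminf (\<lambda>k. \<integral>\<^sup>+\<omega>. ennreal (T (Suc k) \<omega>) \<partial>M)"
    by (rule nn_integral_liminf) measurable
  also have "\<dots> \<le> ennreal (exp (l\<^sup>2 * v / (2 * (1 - l * H))))"
    using T_int by (intro Liminf_le) auto
  finally show ?thesis .
qed

text \<open>Chernoff's method: the exponential of the sum factorizes by independence, and each
  factor is controlled by the bound from \<open>bernstein_mgf_bound\<close>, taken here as a
  hypothesis. Stating it with nonnegative integrals avoids integrability side conditions.\<close>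

lemma bernstein_tail_bound:
  fixes Y :: "'i \<Rightarrow> 'a \<Rightarrow> real"
  assumes I: "finite I" "I \<noteq> {}" and indep: "indep_vars (\<lambda>_. borel) Y I"
    and mgf: "\<And>i l. i \<in> I \<Longrightarrow> 0 \<le> l \<Longrightarrow> l * H < 1 \<Longrightarrow>
      (\<integral>\<^sup>+\<omega>. ennreal (exp (l * Y i \<omega>)) \<partial>M) \<le> ennreal (exp (l\<^sup>2 * v / (2 * (1 - l * H))))"
    and pos: "0 < v" "0 \<le> H" "0 < y"
  shows "prob {\<omega> \<in> space M. y \<le> (\<Sum>i\<in>I. Y i \<omega>)}
    \<le> exp (- (y\<^sup>2 / (2 * (real (card I) * v + H * y))))"
proof -
  have [measurable]: "Y i \<in> borel_measurable M" if "i \<in> I" for i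
    using indep that by (simp add: indep_vars_def2)
  define V where "V = real (card I) * v"
  have V: "0 < V" using I pos by (simp add: V_def card_gt_0_iff)
  define D where "D = V + H * y"
  have D: "0 < D" using V pos by (simp add: D_def add_pos_nonneg)
  \<comment> \<open>The classical Bernstein choice. It gives \<open>1 - l * H = V / D\<close>, so
    the two terms of the exponent become \<open>- y^2 / D\<close> and
    \<open>y^2 / (2 * D)\<close>.\<close>
  define l where "l = y / D"
  have l: "0 < l" using D pos by (simp add: l_def)
  have lH: "1 - l * H = V / D" using D by (simp add: l_def D_def field_simps)
  then have lH1: "l * H < 1" using V D by (smt (verit) divide_pos_pos)
  have "emeasure M {\<omega> \<in> space M. y \<le> (\<Sum>i\<in>I. Y i \<omega>)}
      \<le> ennreal (exp (- l * y)) * (\<integral>\<^sup>+\<omega>\<in>space M. ennreal (exp (l * (\<Sum>i\<in>I. Y i \<omega>))) \<partial>M)"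
    by (intro Chernoff_ineq_nn_integral_ge l) auto
  also have "(\<integral>\<^sup>+\<omega>\<in>space M. ennreal (exp (l * (\<Sum>i\<in>I. Y i \<omega>))) \<partial>M)
      = (\<integral>\<^sup>+\<omega>. (\<Prod>i\<in>I. ennreal (exp (l * Y i \<omega>))) \<partial>M)"
    by (intro nn_integral_cong) (simp add: sum_distrib_left exp_sum I prod_ennreal)
  also have "\<dots> = (\<Prod>i\<in>I. \<integral>\<^sup>+\<omega>. ennreal (exp (l * Y i \<omega>)) \<partial>M)"
    by (intro indep_vars_nn_integral I indep_vars_compose2[OF indep]) auto
  also have "\<dots> \<le> (\<Prod>i\<in>I. ennreal (exp (l\<^sup>2 * v / (2 * (1 - l * H)))))"
    using l lH1 by (intro prod_mono_ennreal mgf) auto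
  also have "\<dots> = ennreal (exp (l\<^sup>2 * V / (2 * (1 - l * H))))"
    by (simp add: ennreal_power exp_of_nat_mult[symmetric] V_def mult_ac)
  also have "ennreal (exp (- l * y)) * \<dots> = ennreal (exp (- l * y + l\<^sup>2 * V / (2 * (1 - l * H))))"
    by (simp only: ennreal_mult'[OF exp_ge_zero, symmetric] exp_add)
  also have "- l * y + l\<^sup>2 * V / (2 * (1 - l * H)) = - (y\<^sup>2 / (2 * D))"
    unfolding lH using V D by (simp add: l_def field_simps power2_eq_square)
  finally show ?thesis
    by (simp add: emeasure_eq_measure D_def V_def mult_left_mono)
qed

end

section \<open>The environment and the history of the process\<close>

context branching_process_random_env
begin

definition env_algebra :: "'a measure" where
  "env_algebra = vimage_algebra (space M) (\<lambda>\<omega> n. \<xi> n \<omega>) (PiM UNIV (\<lambda>_. E))"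

definition offspring_event :: "(nat \<times> nat) set \<Rightarrow> (nat \<Rightarrow> nat \<Rightarrow> nat set) \<Rightarrow> 'a set" where
  "offspring_event J B = {\<omega> \<in> space M. \<forall>(n, i)\<in>J. N n i \<omega> \<in> B n i}"

text \<open>The environment part ranges over the whole sequence, future included; only the offspring
  numbers are cut off at generation \<open>k\<close>. Hence every \<open>\<xi> n\<close> is
  measurable for every \<open>history k\<close>. The rectangle form yields an intersection-stable
  generator on which \<open>cond_law\<close> applies directly.\<close>

definition history_events :: "nat \<Rightarrow> 'a set set" where
  "history_events k =
    {A \<inter> offspring_event J B | A J B. A \<in> sets env_algebra \<and> finite J \<and> J \<subseteq> {..<k} \<times> {1..}}"

definition history :: "nat \<Rightarrow> 'a measure" where
  "history k = sigma (space M) (history_events k)"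

lemma env_measurable [measurable]: "\<xi> n \<in> M \<rightarrow>\<^sub>M E"
  using env_indep by (simp add: indep_vars_def2)

lemma space_env_algebra [simp]: "space env_algebra = space M"
  by (simp add: env_algebra_def)

lemma env_sequence_measurable: "(\<lambda>\<omega> n. \<xi> n \<omega>) \<in> M \<rightarrow>\<^sub>M PiM UNIV (\<lambda>_. E)"
  by (rule measurable_PiM_single') (auto dest: measurable_space[OF env_measurable])

lemma subalgebra_env: "subalgebra M env_algebra"
proof -
  have "sets env_algebra \<subseteq> sets M"
    using measurable_sets[OF env_sequence_measurable]
    unfolding env_algebra_def
    by (subst sets_vimage_algebra2)
       (auto simp: space_PiM dest: measurable_space[OF env_measurable])
  then show ?thesis
    by (simp add: subalgebra_def)
qed

lemma env_measurable_env_algebra: "\<xi> n \<in> env_algebra \<rightarrow>\<^sub>M E"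
proof -
  have "(\<lambda>\<omega> n. \<xi> n \<omega>) \<in> env_algebra \<rightarrow>\<^sub>M PiM UNIV (\<lambda>_. E)"
    unfolding env_algebra_def
    by (rule measurable_vimage_algebra1)
       (auto simp: space_PiM dest: measurable_space[OF env_measurable])
  from measurable_compose[OF this measurable_component_singleton[of n UNIV]] show ?thesis
    by simp
qed

lemma offspring_event_measurable:
  assumes "finite J" "J \<subseteq> UNIV \<times> {1..}"
  shows "offspring_event J B \<in> sets M"
proof -
  have "{\<omega> \<in> space M. \<forall>j\<in>J. N (fst j) (snd j) \<omega> \<in> B (fst j) (snd j)} \<in> sets M"
  proof (rule sets.sets_Collect_finite_All)
    fix j assume "j \<in> J"
    then have "1 \<le> snd j" using assms(2) by auto
    from measurable_sets[OF N_measurable[OF this, of "fst j"], of "B (fst j) (snd j)"]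
    show "{\<omega> \<in> space M. N (fst j) (snd j) \<omega> \<in> B (fst j) (snd j)} \<in> sets M"
      by (simp add: vimage_def Int_def conj_commute)
  qed (fact assms(1))
  then show ?thesis
    by (simp add: offspring_event_def case_prod_beta)
qed

lemma offspring_kernel_subprob:
  "(\<lambda>e. measure_pmf (p e)) \<in> E \<rightarrow>\<^sub>M subprob_algebra (count_space UNIV)"
  using offspring_kernel by (rule measurable_prob_algebraD)

lemma offspring_prob_measurable [measurable]:
  "(\<lambda>e. measure_pmf.prob (p e) A) \<in> borel_measurable E"
  by (rule measure_measurable_subprob_algebra2[OF _ offspring_kernel_subprob]) auto

text \<open>The integrated form of \<open>cond_law\<close>: an environment-measurable weight may be
  moved through the conditional expectation. Later arguments use only this form.\<close>

lemma cond_law_integral: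
  fixes f :: "'a \<Rightarrow> real"
  assumes J: "finite J" "J \<subseteq> UNIV \<times> {1..}"
    and f: "f \<in> borel_measurable env_algebra" "integrable M f"
  shows "(LINT \<omega>|M. f \<omega> * indicator (offspring_event J B) \<omega>)
    = (LINT \<omega>|M. f \<omega> * (\<Prod>(n, i)\<in>J. measure_pmf.prob (p (\<xi> n \<omega>)) (B n i)))"
proof -
  interpret F: finite_measure_subalgebra M env_algebra
    by unfold_locales (fact subalgebra_env)
  interpret F: sigma_finite_subalgebra M env_algebra
    by (rule finite_measure_subalgebra_is_sigma_finite) unfold_locales
  have ev: "offspring_event J B \<in> sets M"
    using J by (rule offspring_event_measurable)
  have fM: "f \<in> borel_measurable M"
    using f(2) by auto
  have "(LINT \<omega>|M. f \<omega> * indicator (offspring_event J B) \<omega>)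
      = (LINT \<omega>|M. f \<omega> * real_cond_exp M env_algebra (indicator (offspring_event J B)) \<omega>)"
    using ev f
    by (intro F.real_cond_exp_intg(2)[symmetric] integrable_real_mult_indicator) auto
  also have "\<dots> = (LINT \<omega>|M. f \<omega> * (\<Prod>(n, i)\<in>J. measure_pmf.prob (p (\<xi> n \<omega>)) (B n i)))"
  proof (rule integral_cong_AE)
    show "(\<lambda>\<omega>. f \<omega> * (\<Prod>(n, i)\<in>J. measure_pmf.prob (p (\<xi> n \<omega>)) (B n i))) \<in> borel_measurable M"
      using fM unfolding case_prod_beta by measurable
    show "AE \<omega> in M. f \<omega> * real_cond_exp M env_algebra (indicator (offspring_event J B)) \<omega>
        = f \<omega> * (\<Prod>(n, i)\<in>J. measure_pmf.prob (p (\<xi> n \<omega>)) (B n i))"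
      using cond_law[OF J, of B] by (auto simp: env_algebra_def offspring_event_def)
  qed (use fM in measurable)
  finally show ?thesis .
qed

lemma history_events_subset: "history_events k \<subseteq> sets M"
proof -
  have "sets env_algebra \<subseteq> sets M"
    using subalgebra_env by (simp add: subalgebra_def)
  then show ?thesis
    unfolding history_events_def
    by (auto intro!: sets.Int offspring_event_measurable)
qed

lemma history_events_Pow: "history_events k \<subseteq> Pow (space M)"
  using history_events_subset sets.sets_into_space by blast

lemma space_history [simp]: "space (history k) = space M"
  using history_events_Pow by (simp add: history_def)

lemma sets_history: "sets (history k) = sigma_sets (space M) (history_events k)"
  using history_events_Pow by (simp add: history_def)

lemma subalgebra_history: "subalgebra M (history k)"
  using sets.sigma_sets_subset[OF history_events_subset]
  by (simp add: subalgebra_def sets_history)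

lemma Int_stable_history_events: "Int_stable (history_events k)"
proof (rule Int_stableI)
  fix U V assume "U \<in> history_events k" "V \<in> history_events k"
  then obtain A J B A' J' B' where
    U: "U = A \<inter> offspring_event J B" "A \<in> sets env_algebra" "finite J" "J \<subseteq> {..<k} \<times> {1..}" and
    V: "V = A' \<inter> offspring_event J' B'" "A' \<in> sets env_algebra" "finite J'" "J' \<subseteq> {..<k} \<times> {1..}"
    unfolding history_events_def by blast
  \<comment> \<open>Indices missing from \<open>J\<close> or \<open>J'\<close> get the trivial
    constraint \<open>UNIV\<close>, so on the union \<open>C\<close> imposes exactly both families
    of constraints.\<close>
  define C where "C = (\<lambda>n i. (if (n, i) \<in> J then B n i else UNIV)
    \<inter> (if (n, i) \<in> J' then B' n i else UNIV))"
  have "U \<inter> V = (A \<inter> A') \<inter> offspring_event (J \<union> J') C"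
    unfolding U V offspring_event_def C_def by auto
  then show "U \<inter> V \<in> history_events k"
    using U V unfolding history_events_def by blast
qed

lemma env_measurable_history: "\<xi> n \<in> history k \<rightarrow>\<^sub>M E"
proof (rule measurableI)
  fix A assume "A \<in> sets E"
  then have "\<xi> n -` A \<inter> space M \<in> sets env_algebra"
    using measurable_sets[OF env_measurable_env_algebra, of A n] by simp
  \<comment> \<open>With \<open>J\<close> empty there is no offspring constraint, so a pure
    environment event is a generator.\<close>
  moreover have "\<xi> n -` A \<inter> space M = (\<xi> n -` A \<inter> space M) \<inter> offspring_event {} (\<lambda>_ _. UNIV)"
    by (auto simp: offspring_event_def)
  ultimately have "\<xi> n -` A \<inter> space M \<in> history_events k"
    unfolding history_events_def by blast
  then show "\<xi> n -` A \<inter> space (history k) \<in> sets (history k)"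
    by (auto simp: sets_history)
qed (auto dest: measurable_space[OF env_measurable])

lemma offspring_measurable_history:
  assumes "j < k" "1 \<le> i"
  shows "N j i \<in> history k \<rightarrow>\<^sub>M count_space UNIV"
proof (rule measurableI)
  fix A :: "nat set"
  have "N j i -` A \<inter> space M = space M \<inter> offspring_event {(j, i)} (\<lambda>_ _. A)"
    by (auto simp: offspring_event_def)
  moreover have "space M \<in> sets env_algebra"
    using sets.top[of env_algebra] by simp
  ultimately have "N j i -` A \<inter> space M \<in> history_events k"
    using assms unfolding history_events_def by fastforce
  then show "N j i -` A \<inter> space (history k) \<in> sets (history k)"
    by (auto simp: sets_history)
qed auto

lemma population_measurable_history:
  "j \<le> k \<Longrightarrow> population N j \<in> history k \<rightarrow>\<^sub>M count_space UNIV"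
proof (induction j)
  case 0
  show ?case by simp
next
  case (Suc j)
  \<comment> \<open>The random number of summands is first frozen at \<open>z\<close>; the countably
    many values of the previous population are then glued together.\<close>
  have "(\<lambda>\<omega>. \<Sum>i = 1..z. N j i \<omega>) \<in> history k \<rightarrow>\<^sub>M count_space UNIV" for z
    using Suc.prems by (intro measurable_sum_nat offspring_measurable_history) auto
  from measurable_compose_countable[OF this Suc.IH] Suc.prems show ?case
    by simp
qed

lemma population_measurable [measurable]: "population N j \<in> M \<rightarrow>\<^sub>M count_space UNIV"
  using measurable_from_subalg[OF subalgebra_history population_measurable_history] by blast

section \<open>Conditional mean of the next generation\<close>

text \<open>
  Given the environment and the generations before \<open>k\<close>, the offspring numbers in generation \<open>k\<close>
  still have law \<open>p (\<xi> k)\<close>: both sides are measures on the history, and they agree on the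
  intersection-stable generator by the conditional law for \<open>J\<close> and for \<open>insert (k, i) J\<close>.
\<close>

lemma nn_integral_history_offspring_eq:
  fixes f :: "'a \<Rightarrow> ennreal"
  assumes f: "f \<in> borel_measurable (history k)" and i: "1 \<le> i"
  shows "(\<integral>\<^sup>+\<omega>. f \<omega> * indicator (N k i -` {c}) \<omega> \<partial>M)
    = (\<integral>\<^sup>+\<omega>. f \<omega> * ennreal (pmf (p (\<xi> k \<omega>)) c) \<partial>M)"
proof -
  define h1 :: "'a \<Rightarrow> ennreal" where "h1 = indicator (N k i -` {c})"
  define q where "q = (\<lambda>\<omega>. pmf (p (\<xi> k \<omega>)) c)"
  define h2 :: "'a \<Rightarrow> ennreal" where "h2 = (\<lambda>\<omega>. ennreal (q \<omega>))"
  note N_measurable[OF i, measurable]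
  have q_env: "q \<in> borel_measurable env_algebra"
    using measurable_compose[OF env_measurable_env_algebra offspring_prob_measurable, of k "{c}"]
    by (simp add: q_def pmf.rep_eq)
  have q_M [measurable]: "q \<in> borel_measurable M"
    by (rule measurable_from_subalg[OF subalgebra_env q_env])
  have h1_M [measurable]: "h1 \<in> borel_measurable M"
    unfolding h1_def by (subst borel_measurable_indicator_iff) measurable
  have h2_M [measurable]: "h2 \<in> borel_measurable M"
    unfolding h2_def by measurable
  \<comment> \<open>The two sides of the claim are integrals of \<open>f\<close> against the
    densities \<open>h1\<close> and \<open>h2\<close>, so it suffices that these measures coincide
    on \<open>history k\<close>.\<close>
  have sub1: "subalgebra (density M h1) (history k)" and sub2: "subalgebra (density M h2) (history k)"
    using subalgebra_history by (simp_all add: subalgebra_def)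
  have "restr_to_subalg (density M h1) (history k) = restr_to_subalg (density M h2) (history k)"
  proof (rule measure_eqI_generator_eq[OF Int_stable_history_events history_events_Pow])
    show sets: "sets (restr_to_subalg (density M h1) (history k)) = sigma_sets (space M) (history_events k)"
      "sets (restr_to_subalg (density M h2) (history k)) = sigma_sets (space M) (history_events k)"
      using sub1 sub2 by (simp_all add: sets_restr_to_subalg sets_history)
    fix U assume U_in: "U \<in> history_events k"
    then obtain A J B where U: "U = A \<inter> offspring_event J B" and A: "A \<in> sets env_algebra"
      and J: "finite J" "J \<subseteq> {..<k} \<times> {1..}"
      unfolding history_events_def by blast
    have AM: "A \<in> sets M"
      using A subalgebra_env by (auto simp: subalgebra_def)
    have UM [measurable]: "U \<in> sets M"
      using U_in history_events_subset by auto
    have UH: "U \<in> sets (history k)"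
      using U_in by (auto simp: sets_history)
    define J' where "J' = insert (k, i) J"
    define B' where "B' = (\<lambda>n j. if (n, j) = (k, i) then {c} else B n j)"
    \<comment> \<open>\<open>J\<close> involves only generations before \<open>k\<close>. The new
      index therefore contributes a separate factor \<open>q\<close> to the product of offspring
      probabilities.\<close>
    have notin: "(k, i) \<notin> J" using J by auto
    have J_sub: "J \<subseteq> UNIV \<times> {1..}" and J': "finite J'" "J' \<subseteq> UNIV \<times> {1..}"
      using J i by (auto simp: J'_def)
    define P where "P = (\<lambda>\<omega>. \<Prod>(n, i)\<in>J. measure_pmf.prob (p (\<xi> n \<omega>)) (B n i))"
    have prod: "(\<Prod>(n, i)\<in>J'. measure_pmf.prob (p (\<xi> n \<omega>)) (B' n i)) = q \<omega> * P \<omega>" for \<omega>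
    proof -
      have "(\<Prod>(n, i)\<in>J. measure_pmf.prob (p (\<xi> n \<omega>)) (B' n i)) = P \<omega>"
        unfolding P_def B'_def using notin by (intro prod.cong) auto
      then show ?thesis
        unfolding J'_def using notin J(1)
        by (simp add: q_def pmf.rep_eq) (simp add: B'_def)
    qed
    have indA: "(indicator A :: 'a \<Rightarrow> real) \<in> borel_measurable env_algebra"
      using A by simp
    have intA: "integrable M (indicator A :: 'a \<Rightarrow> real)"
      using AM by (simp add: less_top[symmetric])
    have intAq: "integrable M (\<lambda>\<omega>. indicator A \<omega> * q \<omega>)"
    proof (rule Bochner_Integration.integrable_bound[OF intA])
      show "(\<lambda>\<omega>. indicator A \<omega> * q \<omega>) \<in> borel_measurable M"
        using AM q_M by (intro borel_measurable_times) auto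
      show "AE \<omega> in M. norm (indicator A \<omega> * q \<omega>) \<le> norm (indicator A \<omega> :: real)"
        by (auto simp: q_def pmf_le_1 split: split_indicator)
    qed
    have "emeasure (restr_to_subalg (density M h1) (history k)) U = (\<integral>\<^sup>+\<omega>. h1 \<omega> * indicator U \<omega> \<partial>M)"
      using UM by (simp add: emeasure_restr_to_subalg[OF sub1 UH] emeasure_density)
    also have "\<dots> = (\<integral>\<^sup>+\<omega>. ennreal (indicator A \<omega> * indicator (offspring_event J' B') \<omega>) \<partial>M)"
      by (rule nn_integral_cong)
         (use notin in \<open>auto simp: U h1_def J'_def B'_def offspring_event_def split: split_indicator\<close>)
    also have "\<dots> = ennreal (LINT \<omega>|M. indicator A \<omega> * indicator (offspring_event J' B') \<omega>)"
      using offspring_event_measurable[OF J'] intA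
      by (intro nn_integral_eq_integral integrable_real_mult_indicator) auto
    also have "(LINT \<omega>|M. indicator A \<omega> * indicator (offspring_event J' B') \<omega>)
        = (LINT \<omega>|M. indicator A \<omega> * (q \<omega> * P \<omega>))"
      unfolding cond_law_integral[OF J' indA intA] prod ..
    \<comment> \<open>Since \<open>q\<close> depends on the environment alone, it is absorbed into
      the weight, and the conditional law for \<open>J\<close> is applied backwards.\<close>
    also have "\<dots> = (LINT \<omega>|M. (indicator A \<omega> * q \<omega>) * P \<omega>)"
      by (simp add: mult.assoc)
    also have "\<dots> = (LINT \<omega>|M. (indicator A \<omega> * q \<omega>) * indicator (offspring_event J B) \<omega>)"
      unfolding P_def using J(1) J_sub intAq indA q_env
      by (intro cond_law_integral[symmetric]) auto
    also have "ennreal \<dots> = (\<integral>\<^sup>+\<omega>. ennreal ((indicator A \<omega> * q \<omega>) * indicator (offspring_event J B) \<omega>) \<partial>M)"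
      using offspring_event_measurable[OF J(1) J_sub] intAq
      by (intro nn_integral_eq_integral[symmetric] integrable_real_mult_indicator) (auto simp: q_def)
    also have "\<dots> = (\<integral>\<^sup>+\<omega>. h2 \<omega> * indicator U \<omega> \<partial>M)"
      by (rule nn_integral_cong) (auto simp: U h2_def split: split_indicator)
    also have "\<dots> = emeasure (restr_to_subalg (density M h2) (history k)) U"
      using UM by (simp add: emeasure_restr_to_subalg[OF sub2 UH] emeasure_density)
    finally show "emeasure (restr_to_subalg (density M h1) (history k)) U
      = emeasure (restr_to_subalg (density M h2) (history k)) U" .
  next
    \<comment> \<open>Uniqueness of measures needs a cover by generators of finite mass. The
      constant sequence \<open>space M\<close> serves: it is the rectangle with empty
      \<open>J\<close>, and \<open>h1\<close> is at most 1.\<close>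
    have "space M = space M \<inter> offspring_event {} (\<lambda>_ _. UNIV)"
      by (auto simp: offspring_event_def)
    moreover have "space M \<in> sets env_algebra"
      using sets.top[of env_algebra] by simp
    ultimately show "range (\<lambda>_::nat. space M) \<subseteq> history_events k"
      unfolding history_events_def by blast
    have "emeasure (restr_to_subalg (density M h1) (history k)) (space M)
        = (\<integral>\<^sup>+\<omega>. h1 \<omega> * indicator (space M) \<omega> \<partial>M)"
      using sets.top[of "history k"]
      by (simp add: emeasure_restr_to_subalg[OF sub1] emeasure_density)
    also have "\<dots> \<le> (\<integral>\<^sup>+\<omega>. indicator (space M) \<omega> \<partial>M)"
      by (intro nn_integral_mono) (simp add: h1_def split: split_indicator)
    also have "\<dots> = emeasure M (space M)" by simp
    finally have "emeasure (restr_to_subalg (density M h1) (history k)) (space M) \<le> emeasure M (space M)" .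
    then show "\<And>i::nat. emeasure (restr_to_subalg (density M h1) (history k)) (space M) \<noteq> \<infinity>"
      by (auto simp: emeasure_space_1 top_unique)
  qed auto
  from arg_cong[OF this, of "\<lambda>m. integral\<^sup>N m f"]
  have "(\<integral>\<^sup>+\<omega>. f \<omega> \<partial>density M h1) = (\<integral>\<^sup>+\<omega>. f \<omega> \<partial>density M h2)"
    using nn_integral_subalgebra2[OF sub1 f] nn_integral_subalgebra2[OF sub2 f] by simp
  then show ?thesis
    unfolding nn_integral_density[OF h1_M measurable_from_subalg[OF subalgebra_history f]]
      nn_integral_density[OF h2_M measurable_from_subalg[OF subalgebra_history f]]
    by (simp add: h1_def h2_def q_def mult.commute)
qed

text \<open>Passes from point masses to the mean by writing the offspring number as the sum of
  \<open>c\<close> times the indicator of the value \<open>c\<close>. Nonnegativity justifies both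
  interchanges of sum and integral.\<close>

lemma nn_integral_history_offspring:
  fixes f :: "'a \<Rightarrow> ennreal"
  assumes f: "f \<in> borel_measurable (history k)" and i: "1 \<le> i"
  shows "(\<integral>\<^sup>+\<omega>. f \<omega> * of_nat (N k i \<omega>) \<partial>M)
    = (\<integral>\<^sup>+\<omega>. f \<omega> * (\<integral>\<^sup>+j. of_nat j \<partial>measure_pmf (p (\<xi> k \<omega>))) \<partial>M)"
proof -
  note N_measurable[OF i, measurable]
  have fM [measurable]: "f \<in> borel_measurable M"
    by (rule measurable_from_subalg[OF subalgebra_history f])
  have ind [measurable]: "(indicator (N k i -` {c}) :: 'a \<Rightarrow> ennreal) \<in> borel_measurable M" for c
    by (subst borel_measurable_indicator_iff) measurable
  have pm [measurable]: "(\<lambda>\<omega>. pmf (p (\<xi> k \<omega>)) c) \<in> borel_measurable M" for c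
    using measurable_compose[OF env_measurable offspring_prob_measurable, of k "{c}"]
    by (simp add: pmf.rep_eq)
  have "of_nat (N k i \<omega>) = (\<Sum>c. of_nat c * indicator (N k i -` {c}) \<omega> :: ennreal)" for \<omega>
    by (subst suminf_finite[of "{N k i \<omega>}"]) (auto split: split_indicator)
  then have "(\<integral>\<^sup>+\<omega>. f \<omega> * of_nat (N k i \<omega>) \<partial>M)
      = (\<integral>\<^sup>+\<omega>. (\<Sum>c. of_nat c * (f \<omega> * indicator (N k i -` {c}) \<omega>)) \<partial>M)"
    by (simp add: ennreal_suminf_cmult[symmetric] mult_ac)
  also have "\<dots> = (\<Sum>c. of_nat c * (\<integral>\<^sup>+\<omega>. f \<omega> * indicator (N k i -` {c}) \<omega> \<partial>M))"
    by (subst nn_integral_suminf) (auto simp: nn_integral_cmult)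
  also have "\<dots> = (\<Sum>c. of_nat c * (\<integral>\<^sup>+\<omega>. f \<omega> * ennreal (pmf (p (\<xi> k \<omega>)) c) \<partial>M))"
    using f i by (simp add: nn_integral_history_offspring_eq)
  also have "\<dots> = (\<integral>\<^sup>+\<omega>. (\<Sum>c. of_nat c * (f \<omega> * ennreal (pmf (p (\<xi> k \<omega>)) c))) \<partial>M)"
    by (subst nn_integral_suminf) (auto simp: nn_integral_cmult)
  also have "\<dots> = (\<integral>\<^sup>+\<omega>. f \<omega> * (\<integral>\<^sup>+j. of_nat j \<partial>measure_pmf (p (\<xi> k \<omega>))) \<partial>M)"
    by (simp add: nn_integral_measure_pmf nn_integral_count_space_nat
        ennreal_suminf_cmult[symmetric] mult_ac)
  finally show ?thesis .
qed

text \<open>The one-step branching identity. The random sum is turned into a series over all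
  potential individuals, each weighted by the indicator that it exists; this weight is known from
  the history, so the previous lemma applies termwise.\<close>

lemma nn_integral_history_population_Suc:
  fixes f :: "'a \<Rightarrow> ennreal"
  assumes f [measurable]: "f \<in> borel_measurable (history k)"
  shows "(\<integral>\<^sup>+\<omega>. f \<omega> * of_nat (population N (Suc k) \<omega>) \<partial>M)
    = (\<integral>\<^sup>+\<omega>. f \<omega> * of_nat (population N k \<omega>) * (\<integral>\<^sup>+j. of_nat j \<partial>measure_pmf (p (\<xi> k \<omega>))) \<partial>M)"
proof -
  note population_measurable_history[OF order_refl, of k, measurable]
  define m :: "'a \<Rightarrow> ennreal" where "m = (\<lambda>\<omega>. \<integral>\<^sup>+j. of_nat j \<partial>measure_pmf (p (\<xi> k \<omega>)))"
  \<comment> \<open>Individuals are numbered from 1 while the series starts at 0, so index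
    \<open>i\<close> stands for individual \<open>Suc i\<close>.\<close>
  define g where "g = (\<lambda>i \<omega>. f \<omega> * (if Suc i \<le> population N k \<omega> then 1 else 0))"
  have g: "g i \<in> borel_measurable (history k)" for i
    unfolding g_def by measurable
  have gM [measurable]: "g i \<in> borel_measurable M" for i
    by (rule measurable_from_subalg[OF subalgebra_history g])
  have mM [measurable]: "m \<in> borel_measurable M"
    unfolding m_def
    by (rule measurable_compose[OF env_measurable],
        rule nn_integral_measurable_subprob_algebra2[OF _ offspring_kernel_subprob]) simp
  have NM [measurable]: "N k (Suc i) \<in> M \<rightarrow>\<^sub>M count_space UNIV" for i
    by (rule N_measurable) simp
  have sum: "(\<Sum>i. g i \<omega> * h i) = (\<Sum>i = 1..population N k \<omega>. f \<omega> * h (i - 1))"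
    for \<omega> and h :: "nat \<Rightarrow> ennreal"
  proof -
    have "(\<Sum>i. g i \<omega> * h i) = (\<Sum>i<population N k \<omega>. f \<omega> * h i)"
      by (subst suminf_finite[of "{..<population N k \<omega>}"]) (auto simp: g_def)
    also have "\<dots> = (\<Sum>i = 1..population N k \<omega>. f \<omega> * h (i - 1))"
      by (rule sum.reindex_bij_witness[of _ "\<lambda>i. i - 1" Suc]) auto
    finally show ?thesis .
  qed
  have "(\<integral>\<^sup>+\<omega>. f \<omega> * of_nat (population N (Suc k) \<omega>) \<partial>M)
      = (\<integral>\<^sup>+\<omega>. (\<Sum>i. g i \<omega> * of_nat (N k (Suc i) \<omega>)) \<partial>M)"
    by (intro nn_integral_cong) (simp add: sum sum_distrib_left)
  also have "\<dots> = (\<Sum>i. \<integral>\<^sup>+\<omega>. g i \<omega> * of_nat (N k (Suc i) \<omega>) \<partial>M)"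
    by (intro nn_integral_suminf) measurable
  also have "\<dots> = (\<Sum>i. \<integral>\<^sup>+\<omega>. g i \<omega> * m \<omega> \<partial>M)"
    using g by (simp add: nn_integral_history_offspring m_def)
  also have "\<dots> = (\<integral>\<^sup>+\<omega>. (\<Sum>i. g i \<omega> * m \<omega>) \<partial>M)"
    by (intro nn_integral_suminf[symmetric]) measurable
  also have "\<dots> = (\<integral>\<^sup>+\<omega>. f \<omega> * of_nat (population N k \<omega>) * m \<omega> \<partial>M)"
    by (intro nn_integral_cong) (simp only: sum, simp add: mult_ac)
  finally show ?thesis
    unfolding m_def .
qed

section \<open>Offspring means and stationarity of the environment\<close>

text \<open>A function of the environment value instead of the sample point, so that independence
  and equality in law of the \<open>\<xi> n\<close> carry over to the means.\<close>

definition kernel_mean :: "'e \<Rightarrow> real" where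
  "kernel_mean e = measure_pmf.expectation (p e) real"

lemma offspring_mean_eq: "offspring_mean \<xi> p n \<omega> = kernel_mean (\<xi> n \<omega>)"
  by (simp add: offspring_mean_def kernel_mean_def)

lemma nn_integral_kernel_measurable [measurable]:
  "(\<lambda>e. \<integral>\<^sup>+j. of_nat j \<partial>measure_pmf (p e)) \<in> borel_measurable E"
  by (rule nn_integral_measurable_subprob_algebra2[OF _ offspring_kernel_subprob]) simp

text \<open>Valid even for a divergent mean, where both sides take the default value 0. This reduces
  measurability of \<open>kernel_mean\<close> to that of a nonnegative integral.\<close>

lemma kernel_mean_eq_enn2real:
  "kernel_mean e = enn2real (\<integral>\<^sup>+j. of_nat j \<partial>measure_pmf (p e))"
  unfolding kernel_mean_def by (subst integral_eq_nn_integral) (simp_all add: ennreal_of_nat_eq_real_of_nat[abs_def])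

lemma kernel_mean_measurable [measurable]: "kernel_mean \<in> borel_measurable E"
  unfolding kernel_mean_eq_enn2real[abs_def] by measurable

lemma kernel_mean_nonneg: "0 \<le> kernel_mean e"
  by (simp add: kernel_mean_eq_enn2real)

text \<open>Both statements concern the common image law of \<open>\<xi> n\<close> and
  \<open>\<xi> 0\<close>. Assumptions made on generation 0 are thereby carried to all
  generations.\<close>

lemma AE_env_shift:
  assumes "{e \<in> space E. P e} \<in> sets E" "AE \<omega> in M. P (\<xi> 0 \<omega>)"
  shows "AE \<omega> in M. P (\<xi> n \<omega>)"
  using AE_distr_iff[OF env_measurable assms(1), of 0] assms(2)
  unfolding env_ident[of n, symmetric] AE_distr_iff[OF env_measurable assms(1)] by simp

lemma nn_integral_env_shift:
  assumes "f \<in> borel_measurable E"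
  shows "(\<integral>\<^sup>+\<omega>. f (\<xi> n \<omega>) \<partial>M) = (\<integral>\<^sup>+\<omega>. f (\<xi> 0 \<omega>) \<partial>M)"
  using env_ident[of n] nn_integral_distr[OF env_measurable[of n], of f]
    nn_integral_distr[OF env_measurable[of 0], of f] assms by simp

section \<open>The normalized population ratio\<close>

text \<open>The variable \<open>W\<close> of the overview: the usual normalized population
  martingale, restarted at generation \<open>n\<^sub>0\<close>.\<close>

definition normalized_growth :: "nat \<Rightarrow> nat \<Rightarrow> 'a \<Rightarrow> real" where
  "normalized_growth n\<^sub>0 n \<omega> = real (population N (n\<^sub>0 + n) \<omega>) / real (population N n\<^sub>0 \<omega>)
    / (\<Prod>j\<in>{n\<^sub>0..<n\<^sub>0 + n}. kernel_mean (\<xi> j \<omega>))"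

lemma normalized_growth_measurable [measurable]:
  "normalized_growth n\<^sub>0 n \<in> borel_measurable M"
  unfolding normalized_growth_def[abs_def] by measurable

context
  assumes finite_mean: "AE \<omega> in M. integrable (measure_pmf (p (\<xi> 0 \<omega>))) real"
    and no_death: "AE \<omega> in M. pmf (p (\<xi> 0 \<omega>)) 0 = 0"
begin

text \<open>Integrability identifies the extended mean with the real one, and at least one child per
  individual forces a mean of at least 1. The means can thus be cancelled, and their logarithms are
  nonnegative.\<close>

lemma AE_kernel_mean:
  "AE \<omega> in M. (\<integral>\<^sup>+j. of_nat j \<partial>measure_pmf (p (\<xi> n \<omega>))) = ennreal (kernel_mean (\<xi> n \<omega>))
    \<and> 1 \<le> kernel_mean (\<xi> n \<omega>)"
proof (rule AE_env_shift)
  show "{e \<in> space E. (\<integral>\<^sup>+j. of_nat j \<partial>measure_pmf (p e)) = ennreal (kernel_mean e)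
    \<and> 1 \<le> kernel_mean e} \<in> sets E"
    by measurable
  show "AE \<omega> in M. (\<integral>\<^sup>+j. of_nat j \<partial>measure_pmf (p (\<xi> 0 \<omega>))) = ennreal (kernel_mean (\<xi> 0 \<omega>))
    \<and> 1 \<le> kernel_mean (\<xi> 0 \<omega>)"
    using finite_mean no_death
  proof eventually_elim
    case (elim \<omega>)
    have "(\<integral>\<^sup>+j. of_nat j \<partial>measure_pmf (p (\<xi> 0 \<omega>))) = ennreal (kernel_mean (\<xi> 0 \<omega>))"
      unfolding kernel_mean_def
      using nn_integral_eq_integral[OF elim(1)] by (simp add: ennreal_of_nat_eq_real_of_nat)
    moreover have "measure_pmf.expectation (p (\<xi> 0 \<omega>)) (\<lambda>_. 1 :: real) \<le> kernel_mean (\<xi> 0 \<omega>)"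
      unfolding kernel_mean_def
    proof (rule integral_mono_AE)
      show "AE j in measure_pmf (p (\<xi> 0 \<omega>)). 1 \<le> real j"
        using elim(2) by (auto simp: AE_measure_pmf_iff set_pmf_iff Suc_le_eq intro!: gr0I)
    qed (use elim in auto)
    ultimately show ?case by simp
  qed
qed

text \<open>The induction step is the martingale identity and preserves the integral. The inequality
  comes only from \<open>n = 0\<close>, where the ratio is 1, or 0 by the convention for division by
  zero.\<close>

lemma nn_integral_normalized_growth_le:
  "(\<integral>\<^sup>+\<omega>. ennreal (normalized_growth n\<^sub>0 n \<omega>) \<partial>M) \<le> 1"
proof (induction n)
  case 0
  have "(\<integral>\<^sup>+\<omega>. ennreal (normalized_growth n\<^sub>0 0 \<omega>) \<partial>M) \<le> (\<integral>\<^sup>+\<omega>. 1 \<partial>M)"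
    by (intro nn_integral_mono) (auto simp: normalized_growth_def divide_self_if)
  then show ?case by (simp add: emeasure_space_1)
next
  case (Suc n)
  define k where "k = n\<^sub>0 + n"
  \<comment> \<open>The full denominator, already including the mean of generation \<open>k\<close>.
    It is \<open>history k\<close>-measurable because the history contains the whole
    environment.\<close>
  define d where "d = (\<lambda>\<omega>. real (population N n\<^sub>0 \<omega>) * (\<Prod>j\<in>{n\<^sub>0..<Suc k}. kernel_mean (\<xi> j \<omega>)))"
  note env_measurable_history [measurable]
  have [measurable]: "population N n\<^sub>0 \<in> history k \<rightarrow>\<^sub>M count_space UNIV"
    by (rule population_measurable_history) (simp add: k_def)
  have f: "(\<lambda>\<omega>. ennreal (1 / d \<omega>)) \<in> borel_measurable (history k)"
    unfolding d_def by measurable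
  have d_nonneg: "0 \<le> d \<omega>" for \<omega>
    unfolding d_def by (intro mult_nonneg_nonneg prod_nonneg) (auto simp: kernel_mean_nonneg)
  have "(\<integral>\<^sup>+\<omega>. ennreal (normalized_growth n\<^sub>0 (Suc n) \<omega>) \<partial>M)
      = (\<integral>\<^sup>+\<omega>. ennreal (1 / d \<omega>) * of_nat (population N (Suc k) \<omega>) \<partial>M)"
  proof (rule nn_integral_cong)
    fix \<omega>
    have "normalized_growth n\<^sub>0 (Suc n) \<omega> = 1 / d \<omega> * real (population N (Suc k) \<omega>)"
      unfolding normalized_growth_def d_def k_def add_Suc_right by simp
    then show "ennreal (normalized_growth n\<^sub>0 (Suc n) \<omega>)
        = ennreal (1 / d \<omega>) * of_nat (population N (Suc k) \<omega>)"
      by (simp only: ennreal_of_nat_eq_real_of_nat ennreal_mult''[OF of_nat_0_le_iff])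
  qed
  also have "\<dots> = (\<integral>\<^sup>+\<omega>. ennreal (1 / d \<omega>) * of_nat (population N k \<omega>)
      * (\<integral>\<^sup>+j. of_nat j \<partial>measure_pmf (p (\<xi> k \<omega>))) \<partial>M)"
    by (rule nn_integral_history_population_Suc[OF f])
  also have "\<dots> = (\<integral>\<^sup>+\<omega>. ennreal (normalized_growth n\<^sub>0 n \<omega>) \<partial>M)"
  proof (rule nn_integral_cong_AE)
    show "AE \<omega> in M. ennreal (1 / d \<omega>) * of_nat (population N k \<omega>)
        * (\<integral>\<^sup>+j. of_nat j \<partial>measure_pmf (p (\<xi> k \<omega>))) = ennreal (normalized_growth n\<^sub>0 n \<omega>)"
      using AE_kernel_mean[of k]
    proof eventually_elim
      case (elim \<omega>)
      have "ennreal (1 / d \<omega>) * of_nat (population N k \<omega>) * (\<integral>\<^sup>+j. of_nat j \<partial>measure_pmf (p (\<xi> k \<omega>)))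
          = ennreal (1 / d \<omega> * real (population N k \<omega>) * kernel_mean (\<xi> k \<omega>))"
        using elim d_nonneg[of \<omega>]
        by (simp add: ennreal_of_nat_eq_real_of_nat ennreal_mult''[symmetric])
      \<comment> \<open>The conditional mean of generation \<open>k\<close> cancels the last factor
        of \<open>d\<close>, which is nonzero almost surely.\<close>
      also have "1 / d \<omega> * real (population N k \<omega>) * kernel_mean (\<xi> k \<omega>) = normalized_growth n\<^sub>0 n \<omega>"
        using elim by (simp add: d_def normalized_growth_def k_def)
      finally show ?case .
    qed
  qed
  finally show ?case using Suc.IH by simp
qed

lemma prob_normalized_growth_ge:
  "prob {\<omega> \<in> space M. exp t \<le> normalized_growth n\<^sub>0 n \<omega>} \<le> exp (- t)"
proof -
  have "emeasure M {\<omega> \<in> space M. exp t \<le> normalized_growth n\<^sub>0 n \<omega>}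
      = emeasure M {\<omega> \<in> space M. 1 \<le> ennreal (exp (- t)) * ennreal (normalized_growth n\<^sub>0 n \<omega>)}"
    by (intro arg_cong[where f = "emeasure M"] Collect_cong conj_cong refl)
       (simp add: ennreal_mult'[symmetric] exp_minus field_simps)
  also have "\<dots> \<le> ennreal (exp (- t)) * (\<integral>\<^sup>+\<omega>\<in>space M. ennreal (normalized_growth n\<^sub>0 n \<omega>) \<partial>M)"
    by (intro nn_integral_Markov_inequality) auto
  also have "(\<integral>\<^sup>+\<omega>\<in>space M. ennreal (normalized_growth n\<^sub>0 n \<omega>) \<partial>M)
      = (\<integral>\<^sup>+\<omega>. ennreal (normalized_growth n\<^sub>0 n \<omega>) \<partial>M)"
    by (intro nn_integral_cong) simp
  also have "ennreal (exp (- t)) * \<dots> \<le> ennreal (exp (- t)) * 1"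
    by (intro mult_left_mono nn_integral_normalized_growth_le) simp
  finally show ?thesis by (simp add: emeasure_eq_measure)
qed

end

end

section \<open>Arithmetic of the split threshold\<close>

text \<open>Makes both halves of the split cost at most \<open>exp (- t)\<close>. With
  \<open>D\<close> the bracket in \<open>t\<close>, the definition of \<open>t\<close> reads
  \<open>2 * (t * D) = s * s\<close>, and both upper bounds on \<open>t\<close> follow from this
  identity.\<close>

lemma bernstein_split_exponent:
  fixes s v H t :: real
  assumes "0 < s" "0 < v" "0 < H" and t_def: "t = s\<^sup>2 / (2 * (v + 6 * (1 + H) * s))"
  shows "0 < t" "t < s" "t \<le> (s - t)\<^sup>2 / (2 * (v + H * (s - t)))"
proof -
  define D where "D = v + 6 * (1 + H) * s"
  have Hs: "0 < H * s" using assms by simp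
  have D: "D = v + 6 * s + 6 * (H * s)" by (simp add: D_def algebra_simps)
  have Dpos: "0 < D" using assms(1,2) Hs unfolding D by linarith
  have tD: "2 * (t * D) = s * s"
    using Dpos unfolding t_def D_def[symmetric] by (simp add: power2_eq_square)
  show t: "0 < t" using assms(1) Dpos unfolding t_def D_def[symmetric] by simp
  have "s * D > s * s"
    using assms(1,2) Hs unfolding D by (intro mult_strict_left_mono) linarith+
  then have "t * D < s * D"
    using tD mult_pos_pos[OF assms(1,1)] by linarith
  then show ts: "t < s" using Dpos by simp
  have q: "0 < v + H * (s - t)" using assms ts by (simp add: add_pos_pos)
  have Ht: "0 \<le> H * t" using assms t by simp
  \<comment> \<open>After clearing the denominator, the surplus of \<open>D\<close> over
    \<open>v + H * (s - t)\<close> is isolated. Keeping only \<open>2 * s\<close> of the bracket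
    leaves \<open>s * s - 2 * s * t\<close>, which is \<open>(s - t)^2\<close> without the square of
    \<open>t\<close>.\<close>
  have "t * (2 * (v + H * (s - t))) = 2 * (t * D) - t * (12 * s + 10 * (H * s) + 2 * (H * t))"
    by (simp add: D algebra_simps)
  also have "\<dots> \<le> s * s - t * (2 * s)"
    unfolding tD using t assms Hs Ht by (intro diff_left_mono mult_left_mono) auto
  also have "\<dots> \<le> (s - t)\<^sup>2"
    by (simp add: power2_eq_square algebra_simps)
  finally show "t \<le> (s - t)\<^sup>2 / (2 * (v + H * (s - t)))"
    using q by (simp add: pos_le_divide_eq)
qed

section \<open>Combination of the two tail bounds\<close>

theorem theorem2p1:
  fixes M :: "'a measure" and E :: "'e measure"
    and \<xi> :: "nat \<Rightarrow> 'a \<Rightarrow> 'e" and p :: "'e \<Rightarrow> nat pmf"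
    and N :: "nat \<Rightarrow> nat \<Rightarrow> 'a \<Rightarrow> nat"
    and Z :: "nat \<Rightarrow> 'a \<Rightarrow> nat"
    and X :: "'a \<Rightarrow> real" and \<mu> \<sigma> H x :: real and n\<^sub>0 n :: nat
  assumes bpre: "branching_process_random_env M E \<xi> p N"
    and Z_def: "Z = population N"
    and finite_mean: "AE \<omega> in M. integrable (measure_pmf (p (\<xi> 0 \<omega>))) real"
    and X_def: "X = (\<lambda>\<omega>. ln (offspring_mean \<xi> p 0 \<omega>))"
    and X_integrable: "integrable M X"
    and \<mu>_def: "\<mu> = (LINT \<omega>|M. X \<omega>)"
    and var_finite: "integrable M (\<lambda>\<omega>. (X \<omega> - \<mu>) ^ 2)"
    and \<sigma>_def: "\<sigma> = sqrt (LINT \<omega>|M. (X \<omega> - \<mu>) ^ 2)"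
    and \<sigma>_pos: "\<sigma> > 0"
    and no_death: "AE \<omega> in M. pmf (p (\<xi> 0 \<omega>)) 0 = 0"
    and H_pos: "H > 0"
    and bernstein: "\<And>k::nat. k \<ge> 2 \<Longrightarrow>
          integrable M (\<lambda>\<omega>. (X \<omega> - \<mu>) ^ k) \<and>
          (LINT \<omega>|M. (X \<omega> - \<mu>) ^ k)
            \<le> 1 / 2 * fact k * H ^ (k - 2) * (LINT \<omega>|M. (X \<omega> - \<mu>) ^ 2)"
    and n: "n \<ge> 1"
    and x: "x > 0"
  shows "measure M {\<omega> \<in> space M.
            (ln (real (Z (n\<^sub>0 + n) \<omega>) / real (Z n\<^sub>0 \<omega>)) - real n * \<mu>) / (\<sigma> * sqrt (real n)) \<ge> x}
         \<le> 2 * exp (- (x ^ 2 / (2 * (1 + 6 * (1 + H) * (x / (\<sigma> * sqrt (real n)))))))"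
proof -
  interpret branching_process_random_env M E \<xi> p N by (fact bpre)
  define v where "v = (LINT \<omega>|M. (X \<omega> - \<mu>) ^ 2)"
  define I where "I = {n\<^sub>0..<n\<^sub>0 + n}"
  define Y where "Y = (\<lambda>j \<omega>. ln (kernel_mean (\<xi> j \<omega>)) - \<mu>)"
  define s where "s = x * (\<sigma> * sqrt (real n))"
  define V where "V = real n * v"
  define t where "t = s\<^sup>2 / (2 * (V + 6 * (1 + H) * s))"
  have v: "0 < v" "\<sigma>\<^sup>2 = v"
    using \<sigma>_pos by (auto simp: \<sigma>_def v_def)
  have X_eq: "X \<omega> = ln (kernel_mean (\<xi> 0 \<omega>))" for \<omega>
    by (simp add: X_def offspring_mean_eq)
  have Y0: "Y 0 = (\<lambda>\<omega>. X \<omega> - \<mu>)"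
    by (simp add: Y_def X_eq)
  have \<mu>_nonneg: "0 \<le> \<mu>"
    unfolding \<mu>_def
    by (rule integral_nonneg_AE)
       (use AE_kernel_mean[OF finite_mean no_death, of 0] in eventually_elim, simp add: X_eq)
  have mgf0: "(\<integral>\<^sup>+\<omega>. ennreal (exp (l * Y 0 \<omega>)) \<partial>M) \<le> ennreal (exp (l\<^sup>2 * v / (2 * (1 - l * H))))"
    if "0 \<le> l" "l * H < 1" for l
    unfolding Y0
    by (rule bernstein_mgf_bound)
       (use X_integrable bernstein v H_pos that in \<open>auto simp: \<mu>_def[symmetric] v_def prob_space\<close>)
  \<comment> \<open>The moment hypothesis concerns generation 0 only; equality in law extends the
    exponential bound to every \<open>j\<close>.\<close>
  have mgf: "(\<integral>\<^sup>+\<omega>. ennreal (exp (l * Y j \<omega>)) \<partial>M) \<le> ennreal (exp (l\<^sup>2 * v / (2 * (1 - l * H))))"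
    if "0 \<le> l" "l * H < 1" for l j
    using mgf0[OF that] nn_integral_env_shift[of "\<lambda>e. ennreal (exp (l * (ln (kernel_mean e) - \<mu>)))" j]
    by (simp add: Y_def)
  have indep: "indep_vars (\<lambda>_. borel) Y I"
    unfolding Y_def
    by (rule indep_vars_compose2[OF indep_vars_subset[OF env_indep]]) auto
  have s_pos: "0 < s" using x n \<sigma>_pos by (simp add: s_def)
  have V_pos: "0 < V" using n v by (simp add: V_def)
  note t = bernstein_split_exponent[OF s_pos V_pos H_pos t_def]
  have card_I: "card I = n" "finite I" "I \<noteq> {}"
    using n by (auto simp: I_def)
  \<comment> \<open>Since \<open>V\<close> is the square of \<open>r\<close>, the factor
    \<open>r^2\<close> cancels from the numerator and the denominator of \<open>t\<close>.\<close>
  have exponent: "t = x ^ 2 / (2 * (1 + 6 * (1 + H) * (x / (\<sigma> * sqrt (real n)))))"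
  proof -
    define r where "r = \<sigma> * sqrt (real n)"
    have r: "0 < r" "V = r\<^sup>2"
      using \<sigma>_pos n v by (simp_all add: r_def V_def power_mult_distrib)
    have "r\<^sup>2 + 6 * (1 + H) * (x * r) = r\<^sup>2 * (1 + 6 * (1 + H) * (x / r))"
      using r(1) by (simp add: field_simps power2_eq_square)
    then show ?thesis
      unfolding t_def s_def r_def[symmetric] r(2)
      using r(1) by (simp add: power_mult_distrib)
  qed
  have [measurable]: "Y j \<in> borel_measurable M" for j
    unfolding Y_def by measurable
  define A where "A = {\<omega> \<in> space M. s - t \<le> (\<Sum>j\<in>I. Y j \<omega>)}"
  define B where "B = {\<omega> \<in> space M. exp t \<le> normalized_growth n\<^sub>0 n \<omega>}"
  have AB: "A \<in> sets M" "B \<in> sets M"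
    unfolding A_def B_def by measurable
  have "measure M {\<omega> \<in> space M.
        (ln (real (Z (n\<^sub>0 + n) \<omega>) / real (Z n\<^sub>0 \<omega>)) - real n * \<mu>) / (\<sigma> * sqrt (real n)) \<ge> x}
      \<le> measure M (A \<union> B)"
  \<comment> \<open>The covering by \<open>A\<close> and \<open>B\<close> is checked only where all
    means are at least 1, hence almost surely.\<close>
  proof (rule finite_measure_mono_AE)
    have "AE \<omega> in M. \<forall>j. 1 \<le> kernel_mean (\<xi> j \<omega>)"
      unfolding AE_all_countable using AE_kernel_mean[OF finite_mean no_death] by auto
    then show "AE \<omega> in M. \<omega> \<in> {\<omega> \<in> space M.
        (ln (real (Z (n\<^sub>0 + n) \<omega>) / real (Z n\<^sub>0 \<omega>)) - real n * \<mu>) / (\<sigma> * sqrt (real n)) \<ge> x}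
        \<longrightarrow> \<omega> \<in> A \<union> B"
    proof (eventually_elim, intro impI)
      fix \<omega>
      assume mean: "\<forall>j. 1 \<le> kernel_mean (\<xi> j \<omega>)"
      define R where "R = real (Z (n\<^sub>0 + n) \<omega>) / real (Z n\<^sub>0 \<omega>)"
      define P where "P = (\<Prod>j\<in>I. kernel_mean (\<xi> j \<omega>))"
      assume "\<omega> \<in> {\<omega> \<in> space M.
        (ln (real (Z (n\<^sub>0 + n) \<omega>) / real (Z n\<^sub>0 \<omega>)) - real n * \<mu>) / (\<sigma> * sqrt (real n)) \<ge> x}"
      then have \<omega>: "\<omega> \<in> space M" and ge: "s \<le> ln R - real n * \<mu>"
        using \<sigma>_pos n by (auto simp: R_def s_def pos_le_divide_eq)
      \<comment> \<open>\<open>ln 0 = 0\<close>, so the event \<open>R = 0\<close> is excluded by \<open>\<mu> \<ge> 0\<close>.\<close>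
      have "R \<noteq> 0"
        using ge s_pos mult_nonneg_nonneg[OF _ \<mu>_nonneg, of "real n"] by auto
      then have R: "0 < R" by (auto simp: R_def zero_less_divide_iff)
      have mean_pos: "0 < kernel_mean (\<xi> j \<omega>)" for j
        using mean by (meson less_le_trans zero_less_one)
      have P: "0 < P" unfolding P_def using mean_pos by (intro prod_pos) auto
      have G: "normalized_growth n\<^sub>0 n \<omega> = R / P"
        by (simp add: normalized_growth_def R_def P_def I_def Z_def)
      have "(\<Sum>j\<in>I. Y j \<omega>) = ln P - real n * \<mu>"
        unfolding Y_def P_def using card_I mean_pos
        by (simp add: sum_subtractf ln_prod less_imp_neq[symmetric])
      then have "s \<le> (\<Sum>j\<in>I. Y j \<omega>) + ln (R / P)"
        using ge R P by (simp add: ln_div)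
      \<comment> \<open>If both alternatives failed, the two terms would add up to less than
        \<open>s\<close>.\<close>
      then consider "s - t \<le> (\<Sum>j\<in>I. Y j \<omega>)" | "t \<le> ln (R / P)" by linarith
      then show "\<omega> \<in> A \<union> B"
        using \<omega> R P by cases (auto simp: A_def B_def G ln_ge_iff)
    qed
  qed (use AB in auto)
  also have "\<dots> \<le> measure M A + measure M B"
    using AB by (rule measure_Un_le)
  also have "measure M A \<le> exp (- ((s - t)\<^sup>2 / (2 * (V + H * (s - t)))))"
    using bernstein_tail_bound[OF card_I(2,3) indep, of H v "s - t"] mgf v H_pos t(2)
    unfolding A_def V_def card_I(1) by auto
  also have "\<dots> \<le> exp (- t)"
    using t(3) by simp
  also have "measure M B \<le> exp (- t)"
    unfolding B_def by (rule prob_normalized_growth_ge[OF finite_mean no_death])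
  finally show ?thesis
    unfolding exponent by simp
qed

end
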